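(* Let $q$ be a prime power, $E=\mathbb{F}_q^n$, and let $F_1,\dots,F_t$ be a shelling of a shellable $q$-complex $\Delta$ on $E$. Suppose there is a positive integer $\ell\le t$ such that $\bigcup_{j=1}^{i-1}\mathcal{R}_{i,j}\ne F_i\setminus\{\mathbf 0\}$ for all $2\le i\le\ell$. Then $\mathring{\Delta}_\ell$ is acyclic, where $\Delta_\ell=\langle F_1,\dots,F_\ell\rangle$.
   Context: A $q$-complex on $E$ is a set of subspaces of $E$ closed under taking subspaces; facets are its inclusion-maximal elements. For a set $\mathcal{A}$ of subspaces, $\langle\mathcal{A}\rangle$ is the set of subspaces contained in some member of $\mathcal{A}$. A shelling is a linear order $F_1,\dots,F_t$ of the facets of a pure $q$-complex (all facets of equal dimension) such that for each $j\ge2$, $\langle F_j\rangle\cap\langle F_1,\dots,F_{j-1}\rangle$ is generated by a nonempty set of subspaces of $F_j$ of dimension $\dim F_j-1$. For $1\le j<i\le t$, $\mathcal{R}_{i,j}=\{x\in F_i:\langle x\rangle\oplus(F_i\cap F_j)=F_i\}$. For a $q$-complex $\Gamma$, $\mathring{\Gamma}=\Gamma\setminus\{\{\mathbf 0\}\}$, with the order topology under inclusion (open sets = down-sets). A space is acyclic if all its reduced singular homology groups vanish. *)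

theory Defs
  imports "HOL-Analysis.Analysis" "HOL-Homology.Homology"
begin

text \<open>The space \<open>E = F\<^sub>q\<^sup>n\<close> is \<^typ>\<open>'a ^ 'n\<close> for a finite field type \<open>'a\<close>, with
  \<open>q = CARD('a)\<close> and \<open>n = CARD('n)\<close>. Subspaces, span and dimension over \<open>'a\<close> are the library's
  \<^const>\<open>vec.subspace\<close>, \<^const>\<open>vec.span\<close> and \<^const>\<open>vec.dim\<close>.\<close>

definition q_complex :: "('a::{field,finite} ^ 'n) set set \<Rightarrow> bool" where
  "q_complex \<Delta> \<longleftrightarrow>
     (\<forall>U\<in>\<Delta>. vec.subspace U) \<and>
     (\<forall>U\<in>\<Delta>. \<forall>V. vec.subspace V \<and> V \<subseteq> U \<longrightarrow> V \<in> \<Delta>)"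

definition facets :: "('a::{field,finite} ^ 'n) set set \<Rightarrow> ('a ^ 'n) set set" where
  "facets \<Delta> = {U \<in> \<Delta>. \<forall>V\<in>\<Delta>. U \<subseteq> V \<longrightarrow> V = U}"

definition pure_q_complex :: "('a::{field,finite} ^ 'n) set set \<Rightarrow> bool" where
  "pure_q_complex \<Delta> \<longleftrightarrow>
     q_complex \<Delta> \<and> (\<forall>U\<in>facets \<Delta>. \<forall>V\<in>facets \<Delta>. vec.dim U = vec.dim V)"

definition q_generated :: "('a::{field,finite} ^ 'n) set set \<Rightarrow> ('a ^ 'n) set set" where
  "q_generated \<A> = {U. vec.subspace U \<and> (\<exists>A\<in>\<A>. U \<subseteq> A)}"

text \<open>The linear order \<open>F\<^sub>1, \<dots>, F\<^sub>t\<close> is a function on \<^typ>\<open>nat\<close> of which only the values on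
  \<open>{1..t}\<close> matter.\<close>

definition shelling ::
    "('a::{field,finite} ^ 'n) set set \<Rightarrow> nat \<Rightarrow> (nat \<Rightarrow> ('a ^ 'n) set) \<Rightarrow> bool" where
  "shelling \<Delta> t F \<longleftrightarrow>
     pure_q_complex \<Delta> \<and>
     bij_betw F {1..t} (facets \<Delta>) \<and>
     (\<forall>j\<in>{2..t}. \<exists>\<A>. \<A> \<noteq> {} \<and>
        (\<forall>A\<in>\<A>. vec.subspace A \<and> A \<subseteq> F j \<and> vec.dim A + 1 = vec.dim (F j)) \<and>
        q_generated {F j} \<inter> q_generated (F ` {1..<j}) = q_generated \<A>)"

definition is_direct_sum ::
    "('a::{field,finite} ^ 'n) set \<Rightarrow> ('a ^ 'n) set \<Rightarrow> ('a ^ 'n) set \<Rightarrow> bool" where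
  "is_direct_sum U V W \<longleftrightarrow> U \<inter> V = {0} \<and> {u + v | u v. u \<in> U \<and> v \<in> V} = W"

definition R_set :: "(nat \<Rightarrow> ('a::{field,finite} ^ 'n) set) \<Rightarrow> nat \<Rightarrow> nat \<Rightarrow> ('a ^ 'n) set" where
  "R_set F i j = {x \<in> F i. is_direct_sum (vec.span {x}) (F i \<inter> F j) (F i)}"

definition punctured :: "('a::{field,finite} ^ 'n) set set \<Rightarrow> ('a ^ 'n) set set" where
  "punctured \<Gamma> = \<Gamma> - {{0}}"

definition order_topology_on :: "'b set set \<Rightarrow> 'b set topology" where
  "order_topology_on P =
     topology (\<lambda>D. D \<subseteq> P \<and> (\<forall>U\<in>D. \<forall>V\<in>P. V \<subseteq> U \<longrightarrow> V \<in> D))"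

lemma openin_order_topology_on:
  "openin (order_topology_on P) D \<longleftrightarrow> D \<subseteq> P \<and> (\<forall>U\<in>D. \<forall>V\<in>P. V \<subseteq> U \<longrightarrow> V \<in> D)"
proof -
  have "istopology (\<lambda>D. D \<subseteq> P \<and> (\<forall>U\<in>D. \<forall>V\<in>P. V \<subseteq> U \<longrightarrow> V \<in> D))"
    unfolding istopology_def by blast
  then show ?thesis
    by (simp add: order_topology_on_def)
qed

lemma topspace_order_topology_on: "topspace (order_topology_on P) = P"
proof
  show "topspace (order_topology_on P) \<subseteq> P"
    using openin_order_topology_on openin_topspace by blast
  have "openin (order_topology_on P) P"
    by (simp add: openin_order_topology_on)
  then show "P \<subseteq> topspace (order_topology_on P)"
    by (rule openin_subset)
qed

text \<open>\<^const>\<open>reduced_homology_group\<close> is singular homology with integer coefficients. It is trivial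
  in every negative degree, so the empty space counts as acyclic; it occurs as the punctured
  complex of \<open>{{0}}\<close>.\<close>

definition acyclic_space :: "'b topology \<Rightarrow> bool" where
  "acyclic_space X \<longleftrightarrow> (\<forall>p::int. trivial_group (reduced_homology_group p X))"

end

theory Submission
  imports Defs
begin

text \<open>Adding the facet \<open>F\<^sub>i\<close> glues the punctured complex \<open>\<langle>F\<^sub>i\<rangle>\<close>, which has a largest element, to
  the punctured \<open>\<Delta>\<^sub>i\<^sub>-\<^sub>1\<close> along the nonzero subspaces of certain hyperplanes \<open>A\<close> of \<open>F\<^sub>i\<close>.
  Each \<open>A\<close> equals \<open>F\<^sub>i \<inter> F\<^sub>j\<close> for some \<open>j < i\<close>, and then \<open>R\<^sub>i\<^sub>j\<close> is the complement of \<open>A\<close> in \<open>F\<^sub>i\<close>;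
  so the hypothesis provides a vector \<open>x \<noteq> 0\<close> lying in all the hyperplanes. The maps
  \<open>U \<mapsto> U + \<langle>x\<rangle>\<close> and \<open>U \<mapsto> \<langle>x\<rangle>\<close> are comparable with the identity and with each other, so the
  intersection is contractible. Down-sets are open, so excision and the long exact sequence of
  the pair carry acyclicity from \<open>\<Delta>\<^sub>i\<^sub>-\<^sub>1\<close> to \<open>\<Delta>\<^sub>i\<close>.\<close>

section \<open>Acyclicity from exact sequences and excision\<close>

lemma exact_seq_imp_trivial_middle:
  assumes "exact_seq ([C, B, A], [g, f])" and "trivial_group A" and "trivial_group C"
  shows "trivial_group B"
proof -
  have f: "group_hom A B f" and g: "g \<in> hom B C" and ker: "kernel B C g = f ` carrier A"
    using assms(1) by auto
  have "f ` carrier A = {\<one>\<^bsub>B\<^esub>}"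
    using assms(2) f group_hom.image_from_trivial_group by blast
  moreover have "kernel B C g = carrier B"
    using assms(3) g by (auto simp: kernel_def trivial_group_def hom_def)
  ultimately show ?thesis
    using f ker by (simp add: trivial_group_def group_hom_def)
qed

text \<open>The relative group sits between the reduced groups of \<open>X\<close> in degree
  \<open>p\<close> and of the subspace in degree \<open>p - 1\<close>. The long exact sequence in
  reduced form asks for a nonempty subspace.\<close>

lemma trivial_relative_homology_group_acyclic:
  assumes "acyclic_space X" and "acyclic_space (subtopology X S)" and "topspace X \<inter> S \<noteq> {}"
  shows "trivial_group (relative_homology_group p X S)"
  using exact_seq_imp_trivial_middle [OF homology_exactness_reduced_1 [OF assms(3)]] assms(1,2)
  by (auto simp: acyclic_space_def)

lemma acyclic_space_if_contractible: "contractible_space X \<Longrightarrow> acyclic_space X"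
  by (simp add: acyclic_space_def trivial_reduced_homology_group_contractible_space)

text \<open>Excising the complement of \<open>V\<close> identifies the homology of the pair
  (\<open>X\<close>, \<open>U\<close>) with that of (\<open>V\<close>, \<open>U \<inter> V\<close>),
  which vanishes because both members are acyclic. The reduced homology of \<open>X\<close> then
  sits between two trivial groups.\<close>

lemma acyclic_space_open_Un:
  assumes U: "openin X U" and V: "openin X V"
    and UV: "U \<union> V = topspace X" "U \<inter> V \<noteq> {}"
    and acU: "acyclic_space (subtopology X U)" and acV: "acyclic_space (subtopology X V)"
    and acUV: "acyclic_space (subtopology X (U \<inter> V))"
  shows "acyclic_space X"
  unfolding acyclic_space_def
proof
  fix p :: int
  have "closedin X (topspace X - V)"
    using V by blast
  \<comment> \<open>The excised set is closed and \<open>U\<close> is open, so the closure-interior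
    condition is just that \<open>U\<close> and \<open>V\<close> cover \<open>X\<close>.\<close>
  then have "X closure_of (topspace X - V) \<subseteq> X interior_of U"
    using U UV(1) by (auto simp: closure_of_closedin interior_of_openin)
  then have "hom_induced p (subtopology X (topspace X - (topspace X - V))) (U - (topspace X - V))
      (subtopology X (topspace X)) U id
    \<in> iso (relative_homology_group p (subtopology X (topspace X - (topspace X - V)))
            (U - (topspace X - V)))
          (relative_homology_group p (subtopology X (topspace X)) U)"
    using openin_subset [OF U] by (rule homology_excision_axiom)
  moreover have "topspace X - (topspace X - V) = V" "U - (topspace X - V) = U \<inter> V"
    using openin_subset [OF V] openin_subset [OF U] by auto
  ultimately have "relative_homology_group p (subtopology X V) (U \<inter> V)
      \<cong> relative_homology_group p X U"
    by (auto intro: is_isoI)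
  moreover have "trivial_group (relative_homology_group p (subtopology X V) (U \<inter> V))"
  proof (rule trivial_relative_homology_group_acyclic [OF acV])
    show "acyclic_space (subtopology (subtopology X V) (U \<inter> V))"
      using acUV by (simp add: subtopology_subtopology Int_ac)
    show "topspace (subtopology X V) \<inter> (U \<inter> V) \<noteq> {}"
      using UV by auto
  qed
  ultimately have "trivial_group (relative_homology_group p X U)"
    using isomorphic_group_triviality group_relative_homology_group by blast
  then show "trivial_group (reduced_homology_group p X)"
    using exact_seq_imp_trivial_middle [OF homology_exactness_reduced_3] acU
    by (auto simp: acyclic_space_def)
qed

section \<open>Order topologies and homotopies between comparable maps\<close>

lemma subtopology_order_topology_on:
  assumes "Q \<subseteq> P"
  shows "subtopology (order_topology_on P) Q = order_topology_on Q"
proof (rule topology_eq [THEN iffD2], intro allI iffI)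
  fix D
  assume "openin (subtopology (order_topology_on P) Q) D"
  then obtain T where "openin (order_topology_on P) T" "D = T \<inter> Q"
    by (auto simp: openin_subtopology)
  then show "openin (order_topology_on Q) D"
    using assms unfolding openin_order_topology_on by blast
next
  fix D
  assume D: "openin (order_topology_on Q) D"
  \<comment> \<open>The open set of \<open>P\<close> that cuts out \<open>D\<close> is the
    down-closure of \<open>D\<close> in \<open>P\<close>.\<close>
  have "D = {V \<in> P. \<exists>U\<in>D. V \<subseteq> U} \<inter> Q"
    using D assms unfolding openin_order_topology_on by blast
  moreover have "openin (order_topology_on P) {V \<in> P. \<exists>U\<in>D. V \<subseteq> U}"
    unfolding openin_order_topology_on by blast
  ultimately show "openin (subtopology (order_topology_on P) Q) D"
    by (auto simp: openin_subtopology)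
qed

lemma homotopic_with_order_topology_on:
  assumes f: "f \<in> P \<rightarrow> Q" "\<And>U V. U \<in> P \<Longrightarrow> V \<in> P \<Longrightarrow> U \<subseteq> V \<Longrightarrow> f U \<subseteq> f V"
    and g: "g \<in> P \<rightarrow> Q" "\<And>U V. U \<in> P \<Longrightarrow> V \<in> P \<Longrightarrow> U \<subseteq> V \<Longrightarrow> g U \<subseteq> g V"
    and le: "\<And>U. U \<in> P \<Longrightarrow> f U \<subseteq> g U"
  shows "homotopic_with (\<lambda>_. True) (order_topology_on P) (order_topology_on Q) f g"
proof -
  \<comment> \<open>The homotopy jumps from \<open>f\<close> to \<open>g\<close> at time 1: since open sets are down-sets and \<open>f \<le> g\<close>,
    the preimage of an open set \<open>D\<close> is \<open>[0,1) \<times> f\<^sup>-\<^sup>1(D) \<union> [0,1] \<times> g\<^sup>-\<^sup>1(D)\<close>.\<close>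
  define h where "h = (\<lambda>(t::real, U). if t < 1 then f U else g U)"
  let ?I = "top_of_set {0..1::real}"
  have "continuous_map (prod_topology ?I (order_topology_on P)) (order_topology_on Q) h"
    unfolding continuous_map_def
  proof (intro conjI allI impI)
    show "h \<in> topspace (prod_topology ?I (order_topology_on P)) \<rightarrow> topspace (order_topology_on Q)"
      using f(1) g(1) by (auto simp: h_def topspace_order_topology_on)
    fix D
    assume D: "openin (order_topology_on Q) D"
    then have down: "V \<in> D" if "U \<in> D" "V \<in> Q" "V \<subseteq> U" for U V
      using that unfolding openin_order_topology_on by blast
    have "f U \<in> D" if "U \<in> P" "g U \<in> D" for U
      using down [OF that(2)] le f(1) that(1) by auto
    then have "{z \<in> topspace (prod_topology ?I (order_topology_on P)). h z \<in> D}
        = {0..<1} \<times> {U \<in> P. f U \<in> D} \<union> {0..1} \<times> {U \<in> P. g U \<in> D}"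
      by (auto simp: h_def topspace_order_topology_on split: if_splits)
    moreover have "openin ?I {0..<1}"
    proof -
      have "{0..<1::real} = {0..1} \<inter> {..<1}"
        by auto
      then show ?thesis
        by (metis open_lessThan openin_open_Int)
    qed
    moreover have "openin ?I {0..1}"
      by auto
    moreover have "openin (order_topology_on P) {U \<in> P. f U \<in> D}"
      using down f unfolding openin_order_topology_on Pi_iff by blast
    moreover have "openin (order_topology_on P) {U \<in> P. g U \<in> D}"
      using down g unfolding openin_order_topology_on Pi_iff by blast
    ultimately show "openin (prod_topology ?I (order_topology_on P))
        {z \<in> topspace (prod_topology ?I (order_topology_on P)). h z \<in> D}"
      by (simp add: openin_Un openin_prod_Times_iff)
  qed
  then show ?thesis
    unfolding homotopic_with_def by (intro exI [of _ h]) (auto simp: h_def)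
qed

text \<open>Both the identity and the constant map at \<open>a\<close> lie below \<open>c\<close>,
  so each is homotopic to \<open>c\<close>.\<close>

lemma contractible_space_order_topology_on:
  assumes a: "a \<in> P" and c: "c \<in> P \<rightarrow> P"
    and mono: "\<And>U V. U \<in> P \<Longrightarrow> V \<in> P \<Longrightarrow> U \<subseteq> V \<Longrightarrow> c U \<subseteq> c V"
    and le: "\<And>U. U \<in> P \<Longrightarrow> U \<subseteq> c U" "\<And>U. U \<in> P \<Longrightarrow> a \<subseteq> c U"
  shows "contractible_space (order_topology_on P)"
proof -
  let ?X = "order_topology_on P"
  have "homotopic_with (\<lambda>_. True) ?X ?X id c"
    using assms by (intro homotopic_with_order_topology_on) auto
  moreover have "homotopic_with (\<lambda>_. True) ?X ?X (\<lambda>_. a) c"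
    using assms by (intro homotopic_with_order_topology_on) auto
  ultimately have "homotopic_with (\<lambda>_. True) ?X ?X id (\<lambda>_. a)"
    using homotopic_with_symD homotopic_with_trans by blast
  then show ?thesis
    unfolding contractible_space_def by blast
qed

section \<open>Contractible punctured q-complexes\<close>

lemma contractible_space_punctured_principal:
  assumes "vec.subspace W" and "W \<noteq> {0}"
  shows "contractible_space (order_topology_on (punctured (q_generated {W})))"
  using assms
  by (intro contractible_space_order_topology_on [where a = W and c = "\<lambda>_. W"])
    (auto simp: punctured_def q_generated_def)

lemma span_singleton_mem_punctured_q_generated:
  assumes "x \<noteq> 0" and "\<A> \<noteq> {}" and "\<And>A. A \<in> \<A> \<Longrightarrow> vec.subspace A \<and> x \<in> A"
  shows "vec.span {x} \<in> punctured (q_generated \<A>)"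
proof -
  have "vec.span {x} \<noteq> {0}"
    using assms(1) vec.span_base [of x "{x}"] by auto
  moreover obtain A where A: "A \<in> \<A>"
    using assms(2) by blast
  moreover have "vec.span {x} \<subseteq> A"
    using assms(3) [OF A] by (intro vec.span_minimal) auto
  ultimately show ?thesis
    by (auto simp: punctured_def q_generated_def)
qed

text \<open>Joining a subspace with the line of \<open>x\<close> stays inside any generator
  containing that subspace, since \<open>x\<close> lies in every generator. This join dominates both
  the identity and the constant map at the line.\<close>

lemma contractible_space_punctured_common_vector:
  assumes "x \<noteq> 0" and "\<A> \<noteq> {}" and sub: "\<And>A. A \<in> \<A> \<Longrightarrow> vec.subspace A \<and> x \<in> A"
  shows "contractible_space (order_topology_on (punctured (q_generated \<A>)))"
proof (rule contractible_space_order_topology_on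
    [where a = "vec.span {x}" and c = "\<lambda>U. vec.span (insert x U)"])
  show "vec.span {x} \<in> punctured (q_generated \<A>)"
    using assms by (rule span_singleton_mem_punctured_q_generated)
  show "(\<lambda>U. vec.span (insert x U)) \<in> punctured (q_generated \<A>) \<rightarrow> punctured (q_generated \<A>)"
  proof
    fix U
    assume "U \<in> punctured (q_generated \<A>)"
    then obtain A where A: "A \<in> \<A>" "U \<subseteq> A"
      by (auto simp: punctured_def q_generated_def)
    then have "vec.span (insert x U) \<subseteq> A"
      using sub by (intro vec.span_minimal) auto
    moreover have "vec.span (insert x U) \<noteq> {0}"
      using \<open>x \<noteq> 0\<close> vec.span_base [of x "insert x U"] by auto
    ultimately show "vec.span (insert x U) \<in> punctured (q_generated \<A>)"
      using A(1) by (auto simp: punctured_def q_generated_def)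
  qed
  show "vec.span (insert x U) \<subseteq> vec.span (insert x V)" if "U \<subseteq> V" for U V
    using that by (intro vec.span_mono) auto
  show "U \<subseteq> vec.span (insert x U)" for U
    by (meson subset_insertI vec.span_superset order_trans)
  show "vec.span {x} \<subseteq> vec.span (insert x U)" for U
    by (intro vec.span_mono) auto
qed

section \<open>Hyperplanes and facets of a shelling\<close>

lemma is_direct_sum_span_hyperplane:
  assumes A: "vec.subspace A" and W: "vec.subspace W" and "A \<subseteq> W"
    and dim: "vec.dim A + 1 = vec.dim W" and x: "x \<in> W" "x \<notin> A"
  shows "is_direct_sum (vec.span {x}) A W"
proof -
  have "vec.span {x} \<inter> A = {0}"
  proof -
    have "k *s x = 0" if "k *s x \<in> A" for k
    proof (cases "k = 0")
      case False
      then have "x = inverse k *s (k *s x)"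
        by (simp add: vec.scale_scale)
      then show ?thesis
        using that x(2) vec.subspace_scale [OF A] by metis
    qed simp
    then show ?thesis
      using A by (auto simp: vec.span_singleton vec.subspace_0)
  qed
  moreover have "vec.span (insert x A) = W"
  proof (rule vec.subspace_dim_equal)
    show "vec.span (insert x A) \<subseteq> W"
      using assms by (intro vec.span_minimal) auto
    \<comment> \<open>Adjoining a vector outside \<open>A\<close> raises the dimension by one, which
      is already that of \<open>W\<close>.\<close>
    have "x \<notin> vec.span A"
      using A x(2) by (metis vec.span_eq_iff)
    then show "vec.dim W \<le> vec.dim (vec.span (insert x A))"
      using dim by (simp add: vec.dim_insert vec.dim_span)
  qed (use W in auto)
  moreover have "vec.span (insert x A) = {u + v | u v. u \<in> vec.span {x} \<and> v \<in> A}"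
  proof -
    have "vec.span ({x} \<union> A) = {u + v | u v. u \<in> vec.span {x} \<and> v \<in> vec.span A}"
      by (rule vec.span_Un)
    moreover have "vec.span A = A"
      using A by (simp add: vec.span_eq_iff)
    ultimately show ?thesis
      by simp
  qed
  ultimately show ?thesis
    by (simp add: is_direct_sum_def)
qed

lemma shelling_subspace:
  assumes "shelling \<Delta> t F" and "i \<in> {1..t}"
  shows "vec.subspace (F i)"
proof -
  have "F i \<in> facets \<Delta>"
    using assms bij_betwE by (fastforce simp: shelling_def)
  then show ?thesis
    using assms(1) by (auto simp: shelling_def pure_q_complex_def q_complex_def facets_def)
qed

lemma shelling_not_subset:
  assumes "shelling \<Delta> t F" and "i \<in> {1..t}" and "j \<in> {1..t}" and "i \<noteq> j"
  shows "\<not> F i \<subseteq> F j"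
proof -
  have bij: "bij_betw F {1..t} (facets \<Delta>)"
    using assms(1) by (simp add: shelling_def)
  then have "F i \<in> facets \<Delta>" "F j \<in> facets \<Delta>" "F i \<noteq> F j"
    using assms(2-4) by (auto simp: bij_betw_def inj_on_eq_iff)
  then show ?thesis
    by (auto simp: facets_def)
qed

text \<open>An earlier facet \<open>F j\<close> above \<open>A\<close> gives
  \<open>A \<subseteq> F i \<inter> F j\<close>. Facets are incomparable, so this intersection is
  proper in \<open>F i\<close> and its dimension cannot exceed that of \<open>A\<close>.\<close>

lemma shelling_hyperplane_eq_Int:
  assumes sh: "shelling \<Delta> t F" and i: "i \<in> {2..t}"
    and A: "vec.subspace A" "A \<subseteq> F i" "vec.dim A + 1 = vec.dim (F i)"
    and gen: "A \<in> q_generated (F ` {1..<i})"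
  obtains j where "j \<in> {1..i-1}" and "A = F i \<inter> F j"
proof -
  obtain j where j: "j \<in> {1..<i}" "A \<subseteq> F j"
    using gen by (auto simp: q_generated_def)
  have sub: "vec.subspace (F i)" "vec.subspace (F j)" "\<not> F i \<subseteq> F j"
    using shelling_subspace [OF sh] shelling_not_subset [OF sh] i j(1) by auto
  then have sub': "vec.subspace (F i \<inter> F j)"
    by (simp add: vec.subspace_inter)
  have "\<not> vec.dim (F i) \<le> vec.dim (F i \<inter> F j)"
    using vec.subspace_dim_equal [OF sub' sub(1)] sub(3) by blast
  then have "A = F i \<inter> F j"
    using A j(2) by (intro vec.subspace_dim_equal sub') auto
  moreover have "j \<in> {1..i-1}"
    using j(1) by auto
  ultimately show thesis
    using that by blast
qed

lemma shelling_step_intersection: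
  assumes sh: "shelling \<Delta> t F" and i: "i \<in> {2..t}"
    and R: "(\<Union>j\<in>{1..i-1}. R_set F i j) \<noteq> F i - {0}"
  obtains \<A> x where "x \<noteq> 0" and "\<A> \<noteq> {}" and "\<And>A. A \<in> \<A> \<Longrightarrow> vec.subspace A \<and> x \<in> A"
    and "q_generated {F i} \<inter> q_generated (F ` {1..<i}) = q_generated \<A>"
proof -
  obtain \<A> where ne: "\<A> \<noteq> {}"
    and \<A>: "\<And>A. A \<in> \<A> \<Longrightarrow> vec.subspace A \<and> A \<subseteq> F i \<and> vec.dim A + 1 = vec.dim (F i)"
    and gen: "q_generated {F i} \<inter> q_generated (F ` {1..<i}) = q_generated \<A>"
    using sh i unfolding shelling_def by meson
  \<comment> \<open>The span of 0 is trivial and cannot complement the proper subspace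
    \<open>F i \<inter> F j\<close>. Hence the union of the \<open>R_set F i j\<close> lies in
    \<open>F i - {0}\<close>, and being different from it means missing some nonzero
    \<open>x\<close>.\<close>
  have "0 \<notin> R_set F i j" if "j \<in> {1..i-1}" for j
  proof
    assume "0 \<in> R_set F i j"
    then have "F i \<inter> F j = F i"
      by (simp add: R_set_def is_direct_sum_def Int_def)
    moreover have "\<not> F i \<subseteq> F j"
      using i that by (intro shelling_not_subset [OF sh]) auto
    ultimately show False
      by blast
  qed
  then have "(\<Union>j\<in>{1..i-1}. R_set F i j) \<subseteq> F i - {0}"
    by (auto simp: R_set_def)
  then obtain x where x: "x \<in> F i" "x \<noteq> 0" "\<And>j. j \<in> {1..i-1} \<Longrightarrow> x \<notin> R_set F i j"
    using R by blast
  have "x \<in> A" if AA: "A \<in> \<A>" for A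
  proof (rule ccontr)
    assume "x \<notin> A"
    have "A \<in> q_generated \<A>"
      using \<A> AA by (auto simp: q_generated_def)
    then obtain j where j: "j \<in> {1..i-1}" "A = F i \<inter> F j"
      using shelling_hyperplane_eq_Int [OF sh i] \<A> [OF AA] gen by blast
    \<comment> \<open>A vector of \<open>F i\<close> outside \<open>A\<close> spans a complement of
      \<open>F i \<inter> F j\<close>, which would put \<open>x\<close> into
      \<open>R_set F i j\<close>.\<close>
    have "is_direct_sum (vec.span {x}) A (F i)"
      using \<A> [OF AA] x(1) \<open>x \<notin> A\<close> shelling_subspace [OF sh, of i] i
      by (intro is_direct_sum_span_hyperplane) auto
    then show False
      using x(1,3) j by (auto simp: R_set_def)
  qed
  then show thesis
    using that [OF x(2) ne] \<A> gen by blast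
qed

section \<open>Induction along the shelling\<close>

lemma openin_order_topology_on_punctured:
  "q_generated \<B> \<subseteq> q_generated \<A> \<Longrightarrow>
    openin (order_topology_on (punctured (q_generated \<A>))) (punctured (q_generated \<B>))"
  unfolding openin_order_topology_on punctured_def q_generated_def by blast

theorem theorem5p14:
  fixes \<Delta> :: "('a::{field,finite} ^ 'n) set set"
    and F :: "nat \<Rightarrow> ('a ^ 'n) set"
    and t l :: nat
  assumes "shelling \<Delta> t F"
    and "1 \<le> l" and "l \<le> t"
    and "\<forall>i\<in>{2..l}. (\<Union>j\<in>{1..i-1}. R_set F i j) \<noteq> F i - {0}"
  shows "acyclic_space (order_topology_on (punctured (q_generated (F ` {1..l}))))"
  using assms(2-4)
proof (induction l rule: dec_induct)
  case base
  have sub: "vec.subspace (F 1)"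
    using shelling_subspace [OF assms(1)] base by simp
  \<comment> \<open>If the first facet is zero, puncturing leaves the empty space; otherwise
    \<open>F 1\<close> is the largest element.\<close>
  show ?case
  proof (cases "F 1 = {0}")
    case True
    then have "punctured (q_generated (F ` {1..1})) = {}"
      by (auto simp: punctured_def q_generated_def dest: vec.subspace_0)
    then show ?thesis
      by (simp add: acyclic_space_def topspace_order_topology_on
          trivial_reduced_homology_group_empty)
  next
    case False
    then show ?thesis
      using contractible_space_punctured_principal [OF sub]
      by (simp add: acyclic_space_if_contractible)
  qed
next
  case (step l)
  define i where "i = Suc l"
  let ?U = "punctured (q_generated (F ` {1..l}))"
  let ?V = "punctured (q_generated {F i})"
  let ?P = "punctured (q_generated (F ` {1..i}))"
  have i: "i \<in> {2..t}" "{1..<i} = {1..l}"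
    using step by (auto simp: i_def)
  obtain \<A> x where x: "x \<noteq> 0" "\<A> \<noteq> {}" "\<And>A. A \<in> \<A> \<Longrightarrow> vec.subspace A \<and> x \<in> A"
    and gen: "q_generated {F i} \<inter> q_generated (F ` {1..<i}) = q_generated \<A>"
    using shelling_step_intersection [OF assms(1) i(1)] step.prems step.hyps i_def
    by (metis One_nat_def Suc_leD Suc_le_mono atLeastAtMost_iff numeral_2_eq_2 order_refl)
  have P: "?U \<union> ?V = ?P"
    by (auto simp: i_def punctured_def q_generated_def atLeastAtMostSuc_conv)
  have UV: "?U \<inter> ?V = punctured (q_generated \<A>)"
    using gen i(2) by (auto simp: punctured_def)
  have mem: "vec.span {x} \<in> ?U \<inter> ?V"
    unfolding UV using x by (rule span_singleton_mem_punctured_q_generated)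
  \<comment> \<open>Only the first facet can be zero: a later one contains the nonzero vector
    \<open>x\<close>.\<close>
  have "F i \<noteq> {0}"
    using mem x(1) vec.span_base [of x "{x}"]
    by (auto simp: punctured_def q_generated_def)
  have "acyclic_space (order_topology_on ?P)"
  proof (rule acyclic_space_open_Un)
    show "openin (order_topology_on ?P) ?U" "openin (order_topology_on ?P) ?V"
      by (rule openin_order_topology_on_punctured; auto simp: q_generated_def i_def)+
    show "?U \<union> ?V = topspace (order_topology_on ?P)"
      unfolding topspace_order_topology_on by (rule P)
    show "?U \<inter> ?V \<noteq> {}"
      using mem by blast
    have "acyclic_space (order_topology_on ?U)"
      using step by simp
    then show "acyclic_space (subtopology (order_topology_on ?P) ?U)"
      using P by (subst subtopology_order_topology_on) auto
    have "acyclic_space (order_topology_on ?V)"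
      using shelling_subspace [OF assms(1), of i] i(1) \<open>F i \<noteq> {0}\<close>
      by (intro acyclic_space_if_contractible contractible_space_punctured_principal) auto
    then show "acyclic_space (subtopology (order_topology_on ?P) ?V)"
      using P by (subst subtopology_order_topology_on) auto
    have "acyclic_space (order_topology_on (?U \<inter> ?V))"
      unfolding UV using x
      by (intro acyclic_space_if_contractible contractible_space_punctured_common_vector) auto
    then show "acyclic_space (subtopology (order_topology_on ?P) (?U \<inter> ?V))"
      using P by (subst subtopology_order_topology_on) auto
  qed
  then show ?case
    by (simp add: i_def)
qed

end
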